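(* Let $(X,d)$ be a $T_1$ quasi-metric space. If $(X,d)$ is normal, then the following assertions are equivalent: (a) $(X,d)$ is a UC space; (b) whenever $(x_n)$ is a sequence in $X$ such that $(I^{+}(x_n))$ converges to $0$, then $(x_n)$ has a cluster point in $(X,d)$; (c) if $(x_n)$ and $(y_n)$ are two sequences in $X$ such that $x_n\neq y_n$ for each $n$ and $(x_n)$ is forward parallel to $(y_n)$ in $(X,d)$, then the sequence $(x_n)$ has a cluster point in $(X,d)$.
   Context: A quasi-metric on a set $X$ is a function $d:X\times X\to\mathbb{R}$ with, for all $x,y,z\in X$: $d(x,y)\ge 0$ and $d(x,x)=0$; $d(x,y)=0=d(y,x)$ implies $x=y$; and $d(x,y)\le d(x,z)+d(z,y)$ (symmetry is not required). The forward topology $\tau(d)$ is generated by the forward balls $B^{+}(x,\epsilon)=\{y\in X: d(x,y)<\epsilon\}$. All topological notions for $(X,d)$ ($T_1$, normal, open, closed, etc.) refer to $\tau(d)$; normal means that disjoint closed sets can be separated by disjoint open sets ($T_1$ is assumed separately). A sequence $(x_n)$ is forward convergent to $x$ if $d(x,x_n)\to 0$. A point $x$ is a cluster point of $(x_n)$ in $(X,d)$ if some subsequence of $(x_n)$ is forward convergent to $x$. A sequence $(x_n)$ is forward parallel to $(y_n)$ if $d(x_n,y_n)\to 0$. A function $f:(X,d)\to(\mathbb{R},|\cdot|)$ is forward continuous if it is continuous for $\tau(d)$ and the usual topology of $\mathbb{R}$; it is uniformly continuous if for every $\epsilon>0$ there is $\delta>0$ such that $d(x,y)<\delta$ implies $|f(x)-f(y)|<\epsilon$.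 $(X,d)$ is a UC space if every forward continuous $f:(X,d)\to(\mathbb{R},|\cdot|)$ is uniformly continuous. The isolation functional is $I^{+}(x)=\inf\{d(x,y): y\in X\setminus\{x\}\}$ for $x\in X$ (with $\inf\emptyset=+\infty$). *)

theory Defs
  imports "HOL-Analysis.Analysis"
begin

definition quasi_metric_on :: "'a set \<Rightarrow> ('a \<Rightarrow> 'a \<Rightarrow> real) \<Rightarrow> bool" where
  "quasi_metric_on X d \<longleftrightarrow>
     (\<forall>x\<in>X. \<forall>y\<in>X. 0 \<le> d x y) \<and>
     (\<forall>x\<in>X. d x x = 0) \<and>
     (\<forall>x\<in>X. \<forall>y\<in>X. d x y = 0 \<and> d y x = 0 \<longrightarrow> x = y) \<and>
     (\<forall>x\<in>X. \<forall>y\<in>X. \<forall>z\<in>X. d x y \<le> d x z + d z y)"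

definition forward_ball :: "'a set \<Rightarrow> ('a \<Rightarrow> 'a \<Rightarrow> real) \<Rightarrow> 'a \<Rightarrow> real \<Rightarrow> 'a set" where
  "forward_ball X d x e = {y \<in> X. d x y < e}"

text \<open>The library's \<^const>\<open>topology_generated_by\<close> takes the union of the generating family as
  the whole space; here that union is \<open>X\<close>, because \<open>d x x = 0\<close> puts each point in its own balls.\<close>
definition forward_topology :: "'a set \<Rightarrow> ('a \<Rightarrow> 'a \<Rightarrow> real) \<Rightarrow> 'a topology" where
  "forward_topology X d =
     topology_generated_by {forward_ball X d x e | x e. x \<in> X \<and> 0 < e}"

definition forward_convergent :: "('a \<Rightarrow> 'a \<Rightarrow> real) \<Rightarrow> (nat \<Rightarrow> 'a) \<Rightarrow> 'a \<Rightarrow> bool" where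
  "forward_convergent d s x \<longleftrightarrow> (\<lambda>n. d x (s n)) \<longlonglongrightarrow> 0"

definition cluster_point :: "'a set \<Rightarrow> ('a \<Rightarrow> 'a \<Rightarrow> real) \<Rightarrow> (nat \<Rightarrow> 'a) \<Rightarrow> 'a \<Rightarrow> bool" where
  "cluster_point X d s x \<longleftrightarrow>
     x \<in> X \<and> (\<exists>r :: nat \<Rightarrow> nat. strict_mono r \<and> forward_convergent d (s \<circ> r) x)"

definition forward_parallel ::
    "('a \<Rightarrow> 'a \<Rightarrow> real) \<Rightarrow> (nat \<Rightarrow> 'a) \<Rightarrow> (nat \<Rightarrow> 'a) \<Rightarrow> bool" where
  "forward_parallel d s t \<longleftrightarrow> (\<lambda>n. d (s n) (t n)) \<longlonglongrightarrow> 0"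

definition forward_continuous :: "'a set \<Rightarrow> ('a \<Rightarrow> 'a \<Rightarrow> real) \<Rightarrow> ('a \<Rightarrow> real) \<Rightarrow> bool" where
  "forward_continuous X d f \<longleftrightarrow> continuous_map (forward_topology X d) euclideanreal f"

definition quasi_uniformly_continuous ::
    "'a set \<Rightarrow> ('a \<Rightarrow> 'a \<Rightarrow> real) \<Rightarrow> ('a \<Rightarrow> real) \<Rightarrow> bool" where
  "quasi_uniformly_continuous X d f \<longleftrightarrow>
     (\<forall>\<epsilon>>0. \<exists>\<delta>>0. \<forall>x\<in>X. \<forall>y\<in>X. d x y < \<delta> \<longrightarrow> \<bar>f x - f y\<bar> < \<epsilon>)"

definition UC_space :: "'a set \<Rightarrow> ('a \<Rightarrow> 'a \<Rightarrow> real) \<Rightarrow> bool" where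
  "UC_space X d \<longleftrightarrow>
     (\<forall>f :: 'a \<Rightarrow> real. forward_continuous X d f \<longrightarrow> quasi_uniformly_continuous X d f)"

text \<open>Extended-real valued, so that the infimum over the empty set is \<open>\<infinity>\<close> when \<open>X\<close> is a
  singleton.\<close>
definition isolation :: "'a set \<Rightarrow> ('a \<Rightarrow> 'a \<Rightarrow> real) \<Rightarrow> 'a \<Rightarrow> ereal" where
  "isolation X d x = (INF y \<in> X - {x}. ereal (d x y))"

end

(* The only implication that needs normality is (a) to (c). Suppose x_n and y_n are parallel, with
   x_n different from y_n, and (x_n) has no cluster point. In a T1 space every subsequence of (x_n)
   then has closed range. If a subsequence of (y_n) converges to z, Urysohn's lemma separates z from
   a tail of the corresponding x_n; if (y_n) has no cluster point either, one extracts a common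
   subsequence whose two ranges are disjoint closed sets and separates those. Either way the
   resulting continuous function jumps by at least 1/2 between x_n and y_n for infinitely many n. *)
theory Submission
  imports Defs
begin

section \<open>Extraction of subsequences and null sequences\<close>

lemma strict_mono_subseq_pairwise:
  fixes P :: "nat \<Rightarrow> nat \<Rightarrow> bool"
  assumes "\<And>m. \<forall>\<^sub>F n in sequentially. P m n"
  shows "\<exists>r :: nat \<Rightarrow> nat. strict_mono r \<and> (\<forall>m n. m < n \<longrightarrow> P (r m) (r n))"
proof -
  \<comment> \<open>Asking for \<open>P m k'\<close> for every \<open>m\<close> up to
    \<open>k\<close>, and not just for the indices chosen so far, lets each choice depend on the
    preceding index alone. Only finitely many eventual conditions are combined at a time.\<close>
  have "\<exists>k'>k. \<forall>m\<le>k. P m k'" for k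
  proof -
    have "\<forall>\<^sub>F n in sequentially. (\<forall>m\<in>{..k}. P m n) \<and> n > k"
      using assms by (intro eventually_conj eventually_ball_finite) (auto intro: eventually_gt_at_top)
    then show ?thesis
      using eventually_happens'[OF sequentially_bot] by fastforce
  qed
  then obtain r where r: "\<And>n. r n < r (Suc n) \<and> (\<forall>m\<le>r n. P m (r (Suc n)))"
    using dependent_nat_choice[of "\<lambda>_ _. True" "\<lambda>_ k k'. k < k' \<and> (\<forall>m\<le>k. P m k')"] by auto
  then have mono: "strict_mono r"
    by (simp add: strict_mono_Suc_iff)
  have "P (r m) (r n)" if "m < n" for m n
  proof -
    obtain k where "n = Suc k" "m \<le> k"
      using \<open>m < n\<close> by (cases n) auto
    then show ?thesis
      using r mono by (simp add: strict_mono_less_eq)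
  qed
  then show ?thesis
    using mono by blast
qed

lemma tendsto_zero_of_less_inverse_Suc:
  fixes u :: "nat \<Rightarrow> real"
  assumes "\<And>n. 0 \<le> u n" "\<And>n. u n < inverse (real (Suc n))"
  shows "u \<longlonglongrightarrow> 0"
proof (rule tendsto_sandwich[OF _ _ tendsto_const LIMSEQ_inverse_real_of_nat])
  show "\<forall>\<^sub>F n in sequentially. u n \<le> inverse (real (Suc n))"
    using assms(2) by (intro always_eventually allI less_imp_le)
qed (use assms(1) in simp)

section \<open>The forward topology\<close>

locale quasi_metric_space =
  fixes X :: "'a set" and d :: "'a \<Rightarrow> 'a \<Rightarrow> real"
  assumes quasi_metric: "quasi_metric_on X d"
begin

lemma dist_nonneg: "x \<in> X \<Longrightarrow> y \<in> X \<Longrightarrow> 0 \<le> d x y"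
  and dist_self: "x \<in> X \<Longrightarrow> d x x = 0"
  and dist_triangle: "x \<in> X \<Longrightarrow> y \<in> X \<Longrightarrow> z \<in> X \<Longrightarrow> d x y \<le> d x z + d z y"
  using quasi_metric by (auto simp: quasi_metric_on_def)

text \<open>The forward balls form a base and not merely a subbase. The triangle inequality puts the
  ball about \<open>y\<close> of radius \<open>e - d x y\<close> inside the ball about
  \<open>x\<close> of radius \<open>e\<close>, using distances in the forward direction
  only.\<close>

lemma openin_forward_topology:
  "openin (forward_topology X d) U \<longleftrightarrow>
     U \<subseteq> X \<and> (\<forall>x\<in>U. \<exists>e>0. forward_ball X d x e \<subseteq> U)" (is "_ \<longleftrightarrow> ?open U")
proof
  assume "openin (forward_topology X d) U"
  then have "generate_topology_on {forward_ball X d x e | x e. x \<in> X \<and> 0 < e} U"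
    by (simp add: forward_topology_def openin_topology_generated_by_iff)
  then show "?open U"
  proof induction
    case (Int U V)
    have "\<exists>e>0. forward_ball X d x e \<subseteq> U \<inter> V" if "x \<in> U \<inter> V" for x
    proof -
      obtain e1 e2 where "e1 > 0" "forward_ball X d x e1 \<subseteq> U" "e2 > 0" "forward_ball X d x e2 \<subseteq> V"
        using Int.IH \<open>x \<in> U \<inter> V\<close> by (meson IntE)
      then show ?thesis
        by (intro exI[of _ "min e1 e2"]) (auto simp: forward_ball_def)
    qed
    then show ?case
      using Int by blast
  next
    case (UN K)
    then show ?case
      by (blast intro: Union_least order_trans[OF _ Union_upper])
  next
    case (Basis U)
    then obtain x e where U: "U = forward_ball X d x e" "x \<in> X" "0 < e"
      by blast
    have "\<exists>e'>0. forward_ball X d y e' \<subseteq> U" if "y \<in> U" for y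
    proof -
      have "z \<in> U" if "z \<in> forward_ball X d y (e - d x y)" for z
        using dist_triangle[of x z y] \<open>y \<in> U\<close> that U by (auto simp: forward_ball_def)
      then show ?thesis
        using \<open>y \<in> U\<close> U by (intro exI[of _ "e - d x y"]) (auto simp: forward_ball_def)
    qed
    then show ?case
      using U by (auto simp: forward_ball_def)
  qed auto
next
  assume U: "?open U"
  then have "\<exists>B. openin (forward_topology X d) B \<and> x \<in> B \<and> B \<subseteq> U" if x: "x \<in> U" for x
  proof -
    obtain e where e: "e > 0" "forward_ball X d x e \<subseteq> U"
      using U x by blast
    moreover have "x \<in> X"
      using U x by blast
    moreover have "openin (forward_topology X d) (forward_ball X d x e)"
      unfolding forward_topology_def using \<open>x \<in> X\<close> e
      by (intro topology_generated_by_Basis) blast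
    ultimately show ?thesis
      using dist_self by (intro exI[of _ "forward_ball X d x e"]) (auto simp: forward_ball_def)
  qed
  then show "openin (forward_topology X d) U"
    by (subst openin_subopen) blast
qed

lemma topspace_forward_topology: "topspace (forward_topology X d) = X"
proof
  show "topspace (forward_topology X d) \<subseteq> X"
    using openin_forward_topology openin_topspace by blast
  have "openin (forward_topology X d) X"
    by (auto simp: openin_forward_topology forward_ball_def intro: exI[of _ 1])
  then show "X \<subseteq> topspace (forward_topology X d)"
    by (rule openin_subset)
qed

text \<open>The axioms only forbid that \<open>d x y\<close> and \<open>d y x\<close> vanish
  together. T1 gives a ball about \<open>x\<close> that misses \<open>y\<close>, which makes each of
  the two distances positive separately.\<close>

lemma t1_imp_dist_pos:
  assumes "t1_space (forward_topology X d)" "x \<in> X" "y \<in> X" "x \<noteq> y"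
  shows "0 < d x y"
proof -
  obtain U where "openin (forward_topology X d) U" "x \<in> U" "y \<notin> U"
    using assms by (auto simp: t1_space_def topspace_forward_topology)
  then obtain e where "e > 0" "forward_ball X d x e \<subseteq> U"
    by (auto simp: openin_forward_topology)
  with \<open>y \<notin> U\<close> \<open>y \<in> X\<close> show ?thesis
    by (force simp: forward_ball_def)
qed

section \<open>Cluster points and closed ranges\<close>

text \<open>This form is the one to negate: a point of \<open>X\<close> that is not a cluster point
  has a ball containing \<open>s n\<close> for only finitely many indices \<open>n\<close>.\<close>

lemma cluster_point_iff_frequently:
  assumes "range s \<subseteq> X"
  shows "cluster_point X d s z \<longleftrightarrow>
           z \<in> X \<and> (\<forall>e>0. \<exists>\<^sub>F n in sequentially. d z (s n) < e)"
proof safe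
  assume c: "cluster_point X d s z"
  then show "z \<in> X"
    by (simp add: cluster_point_def)
  fix e :: real
  assume "e > 0"
  obtain r where r: "strict_mono r" "(\<lambda>n. d z (s (r n))) \<longlonglongrightarrow> 0"
    using c by (auto simp: cluster_point_def forward_convergent_def o_def)
  have "\<exists>\<^sub>F n in sequentially. d z (s (r n)) < e"
    using order_tendstoD(2)[OF r(2) \<open>e > 0\<close>] by (simp add: eventually_frequently)
  \<comment> \<open>By contraposition: what fails from some index on along \<open>s\<close> also
    fails from some index on along \<open>s \<circ> r\<close>.\<close>
  then show "\<exists>\<^sub>F n in sequentially. d z (s n) < e"
    using eventually_subseq[OF r(1), of "\<lambda>n. \<not> d z (s n) < e"] unfolding frequently_def by blast
next
  assume z: "z \<in> X" and freq: "\<forall>e>0. \<exists>\<^sub>F n in sequentially. d z (s n) < e"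
  have ex: "\<exists>k>N. d z (s k) < e" if "e > 0" for e N
    using freq that by (metis frequently_sequentially Suc_le_eq)
  obtain r where r: "\<And>n. d z (s (r n)) < inverse (real (Suc n))" "\<And>n. r n < r (Suc n)"
    using dependent_nat_choice[of "\<lambda>n k. d z (s k) < inverse (real (Suc n))" "\<lambda>_ k k'. k < k'"] ex
    by (metis inverse_positive_iff_positive of_nat_0_less_iff zero_less_Suc)
  have "(\<lambda>n. d z (s (r n))) \<longlonglongrightarrow> 0"
    using r(1) dist_nonneg[OF z] assms
    by (intro tendsto_zero_of_less_inverse_Suc) (auto simp: image_subset_iff)
  then show "cluster_point X d s z"
    using z r(2) by (auto simp: cluster_point_def forward_convergent_def o_def strict_mono_Suc_iff)
qed

lemma cluster_point_subseq:
  assumes "strict_mono r" "cluster_point X d (s \<circ> r) z"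
  shows "cluster_point X d s z"
  using assms strict_mono_o unfolding cluster_point_def by (metis o_assoc)

text \<open>A value in \<open>X\<close> taken infinitely often would itself be a cluster point,
  since \<open>d p p = 0\<close>.\<close>

lemma no_cluster_point_eventually_neq:
  assumes "range s \<subseteq> X" "\<And>z. \<not> cluster_point X d s z"
  shows "\<forall>\<^sub>F n in sequentially. s n \<noteq> p"
proof (cases "p \<in> X")
  case True
  then obtain e where "e > 0" "\<forall>\<^sub>F n in sequentially. \<not> d p (s n) < e"
    using assms cluster_point_iff_frequently[of s p] by (auto simp: frequently_def)
  then show ?thesis
    using dist_self[OF True] by (auto elim: eventually_mono)
next
  case False
  then show ?thesis
    using assms by (intro always_eventually) auto
qed

text \<open>A point off the range has a ball that only finitely many indices can enter. T1 makes the
  distances to those finitely many terms positive, so a smaller ball avoids the whole range.\<close>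

lemma no_cluster_point_closedin_range:
  assumes t1: "t1_space (forward_topology X d)"
    and s: "range s \<subseteq> X" "\<And>z. \<not> cluster_point X d s z"
  shows "closedin (forward_topology X d) (range s)"
proof -
  have "\<exists>e>0. forward_ball X d z e \<subseteq> X - range s" if z: "z \<in> X - range s" for z
  proof -
    obtain e where e: "e > 0" "\<forall>\<^sub>F n in sequentially. \<not> d z (s n) < e"
      using s z cluster_point_iff_frequently[of s z] by (auto simp: frequently_def)
    then obtain N where N: "\<And>n. n \<ge> N \<Longrightarrow> e \<le> d z (s n)"
      by (auto simp: eventually_sequentially not_less)
    \<comment> \<open>Inserting \<open>e\<close> keeps the set nonempty when \<open>N = 0\<close>
      and makes \<open>e'\<close> a lower bound for the tail as well as for the first
      \<open>N\<close> terms.\<close>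
    define e' where "e' = Min (insert e ((\<lambda>n. d z (s n)) ` {..<N}))"
    have "0 < d z (s n)" for n
      using s z by (intro t1_imp_dist_pos[OF t1]) auto
    then have "e' > 0"
      using e by (auto simp: e'_def)
    moreover have "e' \<le> d z (s n)" for n
    proof (cases "n < N")
      case True
      then show ?thesis
        by (auto simp: e'_def intro: Min_le)
    next
      case False
      then have "e \<le> d z (s n)"
        using N by simp
      moreover have "e' \<le> e"
        by (simp add: e'_def)
      ultimately show ?thesis
        by linarith
    qed
    ultimately show ?thesis
      by (intro exI[of _ e']) (fastforce simp: forward_ball_def not_less[symmetric])
  qed
  then show ?thesis
    using s by (auto simp: closedin_def topspace_forward_topology openin_forward_topology)
qed

section \<open>Forward limits, continuity and parallel sequences\<close>

lemma forward_continuous_tendsto: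
  assumes f: "forward_continuous X d f" and "z \<in> X" "range s \<subseteq> X" "(\<lambda>n. d z (s n)) \<longlonglongrightarrow> 0"
  shows "(\<lambda>n. f (s n)) \<longlonglongrightarrow> f z"
proof -
  have "limitin (forward_topology X d) s z sequentially"
    unfolding limitin_def topspace_forward_topology
  proof (intro conjI allI impI)
    fix U
    assume "openin (forward_topology X d) U \<and> z \<in> U"
    then obtain e where "e > 0" "forward_ball X d z e \<subseteq> U"
      by (auto simp: openin_forward_topology)
    then show "\<forall>\<^sub>F n in sequentially. s n \<in> U"
      using order_tendstoD(2)[OF assms(4) \<open>e > 0\<close>] \<open>range s \<subseteq> X\<close>
      by (auto simp: forward_ball_def elim!: eventually_mono)
  qed (rule \<open>z \<in> X\<close>)
  then show ?thesis
    using continuous_map_limit[of "forward_topology X d" euclideanreal f s z sequentially] f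
    by (simp add: forward_continuous_def o_def)
qed

text \<open>The triangle inequality through \<open>s n\<close> carries a limit from \<open>s\<close>
  to \<open>t\<close>. Without symmetry it gives no passage from \<open>t\<close> back to
  \<open>s\<close>.\<close>

lemma forward_parallel_tendsto:
  assumes "z \<in> X" "range s \<subseteq> X" "range t \<subseteq> X"
    and "(\<lambda>n. d z (s n)) \<longlonglongrightarrow> 0" "forward_parallel d s t"
  shows "(\<lambda>n. d z (t n)) \<longlonglongrightarrow> 0"
proof (rule tendsto_sandwich[OF _ _ tendsto_const])
  show "(\<lambda>n. d z (s n) + d (s n) (t n)) \<longlonglongrightarrow> 0"
    using tendsto_add[OF assms(4) assms(5)[unfolded forward_parallel_def]] by simp
  show "\<forall>\<^sub>F n in sequentially. 0 \<le> d z (t n)"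
    using assms by (intro always_eventually allI dist_nonneg) auto
  show "\<forall>\<^sub>F n in sequentially. d z (t n) \<le> d z (s n) + d (s n) (t n)"
    using assms by (intro always_eventually allI dist_triangle) auto
qed

lemma forward_parallel_subseq:
  assumes "forward_parallel d s t" "strict_mono r"
  shows "forward_parallel d (s \<circ> r) (t \<circ> r)"
  using LIMSEQ_subseq_LIMSEQ assms by (fastforce simp: forward_parallel_def o_def)

lemma Urysohn_forward:
  assumes "normal_space (forward_topology X d)"
    and "closedin (forward_topology X d) A" "closedin (forward_topology X d) B" "A \<inter> B = {}"
  obtains f where "forward_continuous X d f" "\<And>a. a \<in> A \<Longrightarrow> f a = 0" "\<And>b. b \<in> B \<Longrightarrow> f b = 1"
proof -
  obtain f where "continuous_map (forward_topology X d) (top_of_set {0..1::real}) f"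
    "f ` A \<subseteq> {0}" "f ` B \<subseteq> {1}"
    using Urysohn_lemma[of "forward_topology X d" A B 0 1] assms by (auto simp: disjnt_def)
  then show thesis
    by (intro that[of f]) (auto simp: forward_continuous_def continuous_map_in_subtopology)
qed

section \<open>Uniform continuity and cluster points of parallel sequences\<close>

lemma UC_space_imp_cluster_point:
  assumes UC: "UC_space X d"
    and t1: "t1_space (forward_topology X d)"
    and normal: "normal_space (forward_topology X d)"
    and x: "range x \<subseteq> X" and y: "range y \<subseteq> X" and neq: "\<And>n. x n \<noteq> y n"
    and par: "forward_parallel d x y"
  shows "\<exists>z. cluster_point X d x z"
proof (rule ccontr)
  assume nc: "\<nexists>z. cluster_point X d x z"
  \<comment> \<open>Both cases end here: a continuous function equal to 1 along a subsequence of
    \<open>x\<close> and tending to 0 along the matching subsequence of \<open>y\<close> keeps a gap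
    above 1/2 at arbitrarily small distances.\<close>
  have contr: False
    if r: "strict_mono r" and f: "forward_continuous X d f" "\<And>n. f (x (r n)) = 1"
      and lim: "(\<lambda>n. f (y (r n))) \<longlonglongrightarrow> 0" for r :: "nat \<Rightarrow> nat" and f
  proof -
    have "quasi_uniformly_continuous X d f"
      using UC f(1) by (simp add: UC_space_def)
    then obtain \<delta> where \<delta>: "\<delta> > 0"
      "\<And>u v. u \<in> X \<Longrightarrow> v \<in> X \<Longrightarrow> d u v < \<delta> \<Longrightarrow> \<bar>f u - f v\<bar> < 1/2"
      unfolding quasi_uniformly_continuous_def by (metis half_gt_zero zero_less_one)
    have "(\<lambda>n. d (x (r n)) (y (r n))) \<longlonglongrightarrow> 0"
      using forward_parallel_subseq[OF par r] by (simp add: forward_parallel_def)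
    then have "\<forall>\<^sub>F n in sequentially. d (x (r n)) (y (r n)) < \<delta> \<and> f (y (r n)) < 1/2"
      using \<delta>(1) by (intro eventually_conj order_tendstoD(2)[OF lim]) (auto intro: order_tendstoD(2))
    then obtain n where n: "d (x (r n)) (y (r n)) < \<delta>" "f (y (r n)) < 1/2"
      using eventually_happens'[OF sequentially_bot] by blast
    then have "\<bar>f (x (r n)) - f (y (r n))\<bar> < 1/2"
      using x y by (intro \<delta>(2)) auto
    then show False
      using n f(2)[of n] by linarith
  qed
  \<comment> \<open>Passing to a subsequence creates no new cluster points, so the closed range
    result applies to every subsequence.\<close>
  have closed: "closedin (forward_topology X d) (range (s \<circ> r))"
    if "strict_mono r" "range s \<subseteq> X" "\<nexists>z. cluster_point X d s z" for r s :: "nat \<Rightarrow> _"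
  proof (rule no_cluster_point_closedin_range[OF t1])
    show "range (s \<circ> r) \<subseteq> X"
      using that by auto
    show "\<not> cluster_point X d (s \<circ> r) z" for z
      using that cluster_point_subseq by blast
  qed
  show False
  proof (cases "\<exists>z. cluster_point X d y z")
    \<comment> \<open>This case is compatible with \<open>x\<close> having no cluster point, because
      limits do not pass from \<open>y\<close> back to \<open>x\<close>.\<close>
    case True
    then obtain z r where z: "z \<in> X" and r: "strict_mono r" and lim: "(\<lambda>n. d z (y (r n))) \<longlonglongrightarrow> 0"
      by (auto simp: cluster_point_def forward_convergent_def o_def)
    have "\<forall>\<^sub>F n in sequentially. x n \<noteq> z"
      using no_cluster_point_eventually_neq[OF x] nc by blast
    then obtain N where N: "\<And>n. n \<ge> N \<Longrightarrow> x n \<noteq> z"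
      by (auto simp: eventually_sequentially)
    \<comment> \<open>The point \<open>z\<close> may occur among the first \<open>N\<close> terms of
      \<open>x\<close>. Since \<open>r n \<ge> n\<close>, shifting the argument by \<open>N\<close>
      skips all of these.\<close>
    define r' where "r' n = r (n + N)" for n
    have r': "strict_mono r'"
      using r by (auto simp: r'_def strict_mono_def)
    have "r' n \<ge> N" for n
      using seq_suble[OF r, of "n + N"] by (simp add: r'_def)
    then have "z \<notin> range (x \<circ> r')"
      using N by auto
    moreover have "closedin (forward_topology X d) {z}"
      using t1 z by (simp add: t1_space_closedin_singleton topspace_forward_topology)
    ultimately obtain f where f: "forward_continuous X d f" "f z = 0"
      "\<And>a. a \<in> range (x \<circ> r') \<Longrightarrow> f a = 1"
      using Urysohn_forward[OF normal _ closed[OF r' x nc], of "{z}"] by auto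
    have "(\<lambda>n. d z (y (r' n))) \<longlonglongrightarrow> 0"
      using LIMSEQ_ignore_initial_segment[OF lim] by (simp add: r'_def)
    then have "(\<lambda>n. f (y (r' n))) \<longlonglongrightarrow> 0"
      using forward_continuous_tendsto[OF f(1) z, of "y \<circ> r'"] y f(2) by (auto simp: o_def)
    then show False
      using contr[OF r' f(1)] f(3) by auto
  next
    case False
    \<comment> \<open>Each fixed value is eventually avoided by both sequences. Along a suitable
      subsequence this excludes coincidences of \<open>x\<close> and \<open>y\<close> at different
      indices, and \<open>neq\<close> excludes those at equal indices.\<close>
    have "\<forall>\<^sub>F n in sequentially. x n \<noteq> y m \<and> y n \<noteq> x m" for m
      using no_cluster_point_eventually_neq[OF x] no_cluster_point_eventually_neq[OF y] nc False
      by (auto intro: eventually_conj)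
    then obtain r :: "nat \<Rightarrow> nat" where r: "strict_mono r"
      and P: "\<And>m n. m < n \<Longrightarrow> x (r n) \<noteq> y (r m) \<and> y (r n) \<noteq> x (r m)"
      using strict_mono_subseq_pairwise[of "\<lambda>m n. x n \<noteq> y m \<and> y n \<noteq> x m"] by blast
    have "y (r m) \<noteq> x (r n)" for m n
      using P[of m n] P[of n m] neq[of "r m"] by (metis nat_neq_iff)
    then have "range (y \<circ> r) \<inter> range (x \<circ> r) = {}"
      by auto
    then obtain f where f: "forward_continuous X d f"
      "\<And>a. a \<in> range (y \<circ> r) \<Longrightarrow> f a = 0" "\<And>a. a \<in> range (x \<circ> r) \<Longrightarrow> f a = 1"
      using Urysohn_forward[OF normal closed[OF r y False] closed[OF r x nc]] by blast
    show False
    proof (rule contr[OF r f(1)])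
      show "f (x (r n)) = 1" for n
        using f(3) by simp
      show "(\<lambda>n. f (y (r n))) \<longlonglongrightarrow> 0"
        using f(2) by simp
    qed
  qed
qed

text \<open>A failure of uniform continuity yields parallel sequences whose images under
  \<open>f\<close> stay at least \<open>e\<close> apart, so their terms differ. Along a subsequence,
  a cluster point of the first is a forward limit of both, and continuity there closes the
  gap.\<close>

lemma cluster_points_imp_UC_space:
  assumes c: "\<And>x y :: nat \<Rightarrow> 'a. range x \<subseteq> X \<Longrightarrow> range y \<subseteq> X \<Longrightarrow> (\<And>n. x n \<noteq> y n) \<Longrightarrow>
                forward_parallel d x y \<Longrightarrow> \<exists>z. cluster_point X d x z"
  shows "UC_space X d"
  unfolding UC_space_def
proof (intro allI impI, rule ccontr)
  fix f :: "'a \<Rightarrow> real"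
  assume f: "forward_continuous X d f" and "\<not> quasi_uniformly_continuous X d f"
  then obtain e where e: "e > 0"
    "\<And>\<delta>. \<delta> > 0 \<Longrightarrow> \<exists>u\<in>X. \<exists>v\<in>X. d u v < \<delta> \<and> \<not> \<bar>f u - f v\<bar> < e"
    unfolding quasi_uniformly_continuous_def by meson
  have "\<exists>u v. u \<in> X \<and> v \<in> X \<and> d u v < inverse (real (Suc n)) \<and> \<not> \<bar>f u - f v\<bar> < e" for n
    using e(2)[of "inverse (real (Suc n))"] by auto
  then obtain x y where xy: "\<And>n. x n \<in> X" "\<And>n. y n \<in> X"
    "\<And>n. d (x n) (y n) < inverse (real (Suc n))" "\<And>n. \<not> \<bar>f (x n) - f (y n)\<bar> < e"
    by metis
  have par: "forward_parallel d x y"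
    unfolding forward_parallel_def using xy(1-3) dist_nonneg
    by (intro tendsto_zero_of_less_inverse_Suc) auto
  have "x n \<noteq> y n" for n
    using xy(4)[of n] e(1) by auto
  then have "\<exists>z. cluster_point X d x z"
    using xy(1,2) par by (intro c) auto
  then obtain z r where z: "z \<in> X" and r: "strict_mono r"
    and lim: "(\<lambda>n. d z ((x \<circ> r) n)) \<longlonglongrightarrow> 0"
    by (auto simp: cluster_point_def forward_convergent_def)
  have X: "range (x \<circ> r) \<subseteq> X" "range (y \<circ> r) \<subseteq> X"
    using xy by auto
  have "(\<lambda>n. d z ((y \<circ> r) n)) \<longlonglongrightarrow> 0"
    using forward_parallel_tendsto[OF z X lim] forward_parallel_subseq[OF par r] by blast
  then have "(\<lambda>n. f ((x \<circ> r) n) - f ((y \<circ> r) n)) \<longlonglongrightarrow> f z - f z"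
    using lim X by (intro tendsto_diff forward_continuous_tendsto[OF f z])
  then have "\<forall>\<^sub>F n in sequentially. \<bar>f (x (r n)) - f (y (r n))\<bar> < e"
    using tendstoD[OF _ e(1)] by (fastforce simp: dist_real_def)
  then show False
    using eventually_happens'[OF sequentially_bot] xy(4) by blast
qed

section \<open>The isolation functional and parallel sequences\<close>

lemma isolation_nonneg: "x \<in> X \<Longrightarrow> 0 \<le> isolation X d x"
  by (auto simp: isolation_def intro!: INF_greatest dist_nonneg)

text \<open>The point \<open>y n\<close> competes in the infimum at \<open>x n\<close>, which
  squeezes the isolation between 0 and \<open>d (x n) (y n)\<close>.\<close>

lemma forward_parallel_imp_isolation_tendsto:
  assumes "range x \<subseteq> X" "range y \<subseteq> X" "\<And>n. x n \<noteq> y n" "forward_parallel d x y"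
  shows "(\<lambda>n. isolation X d (x n)) \<longlonglongrightarrow> 0"
proof (rule tendsto_sandwich[OF _ _ tendsto_const])
  show "\<forall>\<^sub>F n in sequentially. 0 \<le> isolation X d (x n)"
    using assms isolation_nonneg by (intro always_eventually) auto
  have "isolation X d (x n) \<le> ereal (d (x n) (y n))" for n
    unfolding isolation_def using assms by (intro INF_lower) (auto simp: image_subset_iff, metis)
  then show "\<forall>\<^sub>F n in sequentially. isolation X d (x n) \<le> ereal (d (x n) (y n))"
    by simp
  show "(\<lambda>n. ereal (d (x n) (y n))) \<longlonglongrightarrow> 0"
    using assms(4) by (simp add: forward_parallel_def zero_ereal_def)
qed

text \<open>The infimum need not be attained. Thinning out \<open>x\<close> until the isolation lies
  strictly below \<open>inverse (real (Suc n))\<close> leaves room to choose a partner below the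
  same bound.\<close>

lemma isolation_tendsto_imp_parallel_subseq:
  assumes x: "range x \<subseteq> X" and lim: "(\<lambda>n. isolation X d (x n)) \<longlonglongrightarrow> 0"
  obtains r y where "strict_mono r" "range y \<subseteq> X" "\<And>n. x (r n) \<noteq> y n"
    "forward_parallel d (x \<circ> r) y"
proof -
  have "\<exists>k>m. isolation X d (x k) < ereal e" if "e > 0" for e m
  proof -
    have "\<forall>\<^sub>F k in sequentially. isolation X d (x k) < ereal e \<and> k > m"
      using order_tendstoD(2)[OF lim, of "ereal e"] that
      by (auto intro: eventually_conj eventually_gt_at_top)
    then show ?thesis
      using eventually_happens'[OF sequentially_bot] by blast
  qed
  then obtain r where r: "\<And>n. isolation X d (x (r n)) < ereal (inverse (real (Suc n)))"
      "\<And>n. r n < r (Suc n)"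
    using dependent_nat_choice[of "\<lambda>n k. isolation X d (x k) < ereal (inverse (real (Suc n)))"
        "\<lambda>_ k k'. k < k'"]
    by (metis inverse_positive_iff_positive of_nat_0_less_iff zero_less_Suc)
  \<comment> \<open>A strict finite upper bound on the infimum forces \<open>X - {x (r n)}\<close>
    to be nonempty, the empty infimum being infinite.\<close>
  have "\<exists>v. v \<in> X \<and> x (r n) \<noteq> v \<and> d (x (r n)) v < inverse (real (Suc n))" for n
    using r(1)[of n] by (auto simp: isolation_def INF_less_iff)
  then obtain y where y: "\<And>n. y n \<in> X" "\<And>n. x (r n) \<noteq> y n"
    "\<And>n. d (x (r n)) (y n) < inverse (real (Suc n))"
    by metis
  have "forward_parallel d (x \<circ> r) y"
    unfolding forward_parallel_def o_def using x y dist_nonneg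
    by (intro tendsto_zero_of_less_inverse_Suc) (auto simp: image_subset_iff)
  then show thesis
    using that[of r y] r(2) y by (auto simp: strict_mono_Suc_iff)
qed

end

theorem theorem4p3:
  fixes X :: "'a set" and d :: "'a \<Rightarrow> 'a \<Rightarrow> real"
  assumes "quasi_metric_on X d"
    and "t1_space (forward_topology X d)"
    and "normal_space (forward_topology X d)"
  shows "(UC_space X d \<longleftrightarrow>
           (\<forall>x :: nat \<Rightarrow> 'a. range x \<subseteq> X \<longrightarrow>
              (\<lambda>n. isolation X d (x n)) \<longlonglongrightarrow> 0 \<longrightarrow> (\<exists>z. cluster_point X d x z))) \<and>
         (UC_space X d \<longleftrightarrow>
           (\<forall>(x :: nat \<Rightarrow> 'a) (y :: nat \<Rightarrow> 'a). range x \<subseteq> X \<longrightarrow> range y \<subseteq> X \<longrightarrow>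
              (\<forall>n. x n \<noteq> y n) \<longrightarrow> forward_parallel d x y \<longrightarrow> (\<exists>z. cluster_point X d x z)))"
    (is "(_ \<longleftrightarrow> ?b) \<and> (_ \<longleftrightarrow> ?c)")
proof -
  interpret quasi_metric_space X d
    using assms(1) by unfold_locales
  have "UC_space X d \<Longrightarrow> ?c"
    using UC_space_imp_cluster_point assms by blast
  moreover have "?c \<Longrightarrow> UC_space X d"
    by (rule cluster_points_imp_UC_space) blast
  moreover have "?b \<Longrightarrow> ?c"
    using forward_parallel_imp_isolation_tendsto by blast
  \<comment> \<open>Only a subsequence of \<open>x\<close> acquires a parallel partner. That
    suffices, because its cluster points are cluster points of \<open>x\<close>.\<close>
  moreover have ?b if c: ?c
  proof (intro allI impI)
    fix x :: "nat \<Rightarrow> 'a"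
    assume x: "range x \<subseteq> X" and "(\<lambda>n. isolation X d (x n)) \<longlonglongrightarrow> 0"
    then obtain r y where ry: "strict_mono r" "range y \<subseteq> X" "\<And>n. x (r n) \<noteq> y n"
      "forward_parallel d (x \<circ> r) y"
      using isolation_tendsto_imp_parallel_subseq by blast
    moreover have "range (x \<circ> r) \<subseteq> X"
      using x by auto
    ultimately obtain z where "cluster_point X d (x \<circ> r) z"
      using c[rule_format, of "x \<circ> r" y] by auto
    then show "\<exists>z. cluster_point X d x z"
      using cluster_point_subseq ry(1) by blast
  qed
  ultimately show ?thesis
    by blast
qed

end
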